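(* Let $R$ be a commutative ring with unity, $I$ a proper ideal of $R$, and $f(t)\in R[t]$ a monic polynomial of degree $k>0$. Then the ring extensions $R\subseteq \mathcal R_+/(I^kf(t))\subseteq R[t]/(f(t))$ are both integral and the three rings have the same Krull dimension.
   Context: The Rees algebra of $R$ with respect to $I$ is $\mathcal R_+=\bigoplus_{n\ge 0} I^nt^n\subseteq R[t]$. $(I^kf(t))$ denotes the ideal $f(t)R[t]\cap\mathcal R_+$ of $\mathcal R_+$. The inclusions are the natural ones, induced by $R\subseteq\mathcal R_+\subseteq R[t]$. *)

theory Defs
  imports
    "HOL-Algebra.UnivPoly"
    "HOL-Algebra.Ideal_Product"
    "HOL-Algebra.QuotRing"
    "HOL-Library.Extended_Real"
begin

definition UP_monic :: "('a, 'm) ring_scheme \<Rightarrow> (nat \<Rightarrow> 'a) \<Rightarrow> bool" where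
  "UP_monic R p \<longleftrightarrow> p \<in> carrier (UP R) \<and> coeff (UP R) p (deg R p) = \<one>\<^bsub>R\<^esub>"

(* The power of I is taken in the multiplicative monoid of ideals, so that the
   0-th power of I is the whole ring. *)
definition rees_algebra :: "('a, 'm) ring_scheme \<Rightarrow> 'a set \<Rightarrow> ('a, nat \<Rightarrow> 'a) up_ring" where
  "rees_algebra R I =
     (UP R)\<lparr>carrier := {p \<in> carrier (UP R). \<forall>n. coeff (UP R) p n \<in> I [^]\<^bsub>ideals_set R\<^esub> n}\<rparr>"

definition rees_ideal :: "('a, 'm) ring_scheme \<Rightarrow> 'a set \<Rightarrow> (nat \<Rightarrow> 'a) \<Rightarrow> (nat \<Rightarrow> 'a) set" where
  "rees_ideal R I f = (PIdl\<^bsub>UP R\<^esub> f) \<inter> carrier (rees_algebra R I)"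

definition rees_quotient ::
  "('a, 'm) ring_scheme \<Rightarrow> 'a set \<Rightarrow> (nat \<Rightarrow> 'a) \<Rightarrow> (nat \<Rightarrow> 'a) set ring" where
  "rees_quotient R I f = rees_algebra R I Quot rees_ideal R I f"

definition UP_quotient ::
  "('a, 'm) ring_scheme \<Rightarrow> (nat \<Rightarrow> 'a) \<Rightarrow> (nat \<Rightarrow> 'a) set ring" where
  "UP_quotient R f = UP R Quot (PIdl\<^bsub>UP R\<^esub> f)"

definition base_to_rees ::
  "('a, 'm) ring_scheme \<Rightarrow> 'a set \<Rightarrow> (nat \<Rightarrow> 'a) \<Rightarrow> 'a \<Rightarrow> (nat \<Rightarrow> 'a) set" where
  "base_to_rees R I f = (\<lambda>r. rees_ideal R I f +>\<^bsub>rees_algebra R I\<^esub> monom (UP R) r 0)"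

(* The projection of R[t] onto R[t]/(f) is constant on each coset of the Rees ideal;
   its value there is the image of the coset under the induced map. *)
definition rees_to_UP ::
  "('a, 'm) ring_scheme \<Rightarrow> (nat \<Rightarrow> 'a) \<Rightarrow> (nat \<Rightarrow> 'a) set \<Rightarrow> (nat \<Rightarrow> 'a) set" where
  "rees_to_UP R f = (\<lambda>X. the_elem ((\<lambda>p. (PIdl\<^bsub>UP R\<^esub> f) +>\<^bsub>UP R\<^esub> p) ` X))"

definition ring_extension ::
  "('a, 'm) ring_scheme \<Rightarrow> ('b, 'n) ring_scheme \<Rightarrow> ('a \<Rightarrow> 'b) \<Rightarrow> bool" where
  "ring_extension A B h \<longleftrightarrow> ring_hom_cring A B h \<and> inj_on h (carrier A)"

definition integral_over ::
  "('a, 'm) ring_scheme \<Rightarrow> ('b, 'n) ring_scheme \<Rightarrow> ('a \<Rightarrow> 'b) \<Rightarrow> 'b \<Rightarrow> bool" where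
  "integral_over A B h b \<longleftrightarrow> (\<exists>p. UP_monic A p \<and> eval A B h b p = \<zero>\<^bsub>B\<^esub>)"

definition integral_extension ::
  "('a, 'm) ring_scheme \<Rightarrow> ('b, 'n) ring_scheme \<Rightarrow> ('a \<Rightarrow> 'b) \<Rightarrow> bool" where
  "integral_extension A B h \<longleftrightarrow>
     ring_extension A B h \<and> (\<forall>b \<in> carrier B. integral_over A B h b)"

(* The supremum of the lengths n of chains P 0 < ... < P n of prime ideals;
   the zero ring, which has no prime ideals, gets dimension minus infinity. *)
definition krull_dim :: "('a, 'm) ring_scheme \<Rightarrow> ereal" where
  "krull_dim R =
     (SUP n \<in> {n. \<exists>P :: nat \<Rightarrow> 'a set.
                    (\<forall>i\<le>n. primeideal (P i) R) \<and> (\<forall>i<n. P i \<subset> P (Suc i))}.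
        ereal (real n))"

end

theory Submission
  imports Defs "HOL-Algebra.Subrings" "HOL-Algebra.Ring_Divisibility"
begin

text \<open>
  Write \<open>C = R[t]/(f)\<close> and let \<open>B\<close> be the quotient of the Rees algebra. Since \<open>(I\<^sup>k f)\<close> is the
  kernel of the composite of the inclusion of the Rees algebra in \<open>R[t]\<close> with the projection to
  \<open>C\<close>, the ring \<open>B\<close> embeds in \<open>C\<close>. A nonzero multiple of the monic polynomial \<open>f\<close> has degree at
  least \<open>k > 0\<close>, so no nonzero constant lies in \<open>(f)\<close> and \<open>R\<close> embeds in \<open>B\<close>.

  Division by \<open>f\<close> shows that the classes of \<open>1, t, \<dots>, t\<^sup>k\<^sup>-\<^sup>1\<close> generate \<open>C\<close> as an \<open>R\<close>-module, and
  an extension that is finite as a module is integral (\<open>finite_imp_integral\<close>). Integrality of \<open>C\<close>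
  over \<open>R\<close> passes to both steps of the tower \<open>R \<subseteq> B \<subseteq> C\<close> (\<open>integral_extension_tower\<close>): an element
  of \<open>B\<close> is a root of whatever monic polynomial over \<open>R\<close> kills its image in \<open>C\<close>, and a monic
  polynomial over \<open>R\<close> is also one over \<open>B\<close>. Finally an integral extension preserves the Krull
  dimension (\<open>krull_dim_integral_extension\<close>): by \<open>lying_over\<close>, a chain of primes below lifts one
  step at a time, and by \<open>incomparability\<close>, a chain of primes above contracts to a strict chain.

  The finiteness criterion is usually derived from the Cayley-Hamilton theorem. Here the
  determinant is replaced by elimination without division: if \<open>b\<close> acts on generators
  \<open>m\<^sub>0, \<dots>, m\<^sub>n\<close> through a matrix, then the \<open>m\<^sub>j\<close> solve a homogeneous linear system whose coefficients
  are polynomials in \<open>b\<close>, monic of some degree \<open>d\<close> on the diagonal and of degree less than \<open>d\<close> off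
  it. Eliminating one unknown preserves this shape with \<open>2 d\<close> in place of \<open>d\<close>, and what remains
  at the end is a single equation \<open>p(b) m\<^sub>0 = 0\<close> with \<open>p\<close> monic.
\<close>

section \<open>Values of polynomials at a point\<close>

context ring_hom_cring
begin

text \<open>
  \<open>poly_values b c n\<close> is the set of the values at \<open>b\<close> of the polynomials \<open>c X\<^sup>n + (lower terms)\<close> over
  \<open>R\<close>, generated by the Horner scheme. Thus \<open>c = \<one>\<close> gives the values of monic polynomials of degree
  \<open>n\<close>, and \<open>c = \<zero>\<close> those of polynomials of degree less than \<open>n\<close>. Integrality and the theorems on
  primes need only these values, and the recursion lets them be proved by induction on the degree
  without handling the polynomials themselves.
\<close>

primrec poly_values :: "'c \<Rightarrow> 'a \<Rightarrow> nat \<Rightarrow> 'c set" where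
  "poly_values b c 0 = {h c}"
| "poly_values b c (Suc n) = {b \<otimes>\<^bsub>S\<^esub> v \<oplus>\<^bsub>S\<^esub> h a | v a. v \<in> poly_values b c n \<and> a \<in> carrier R}"

lemma poly_values_closed:
  "b \<in> carrier S \<Longrightarrow> c \<in> carrier R \<Longrightarrow> v \<in> poly_values b c n \<Longrightarrow> v \<in> carrier S"
  by (induction n arbitrary: v) auto

lemma poly_values_SucI:
  "v \<in> poly_values b c n \<Longrightarrow> a \<in> carrier R \<Longrightarrow> b \<otimes>\<^bsub>S\<^esub> v \<oplus>\<^bsub>S\<^esub> h a \<in> poly_values b c (Suc n)"
  by auto

lemma poly_values_times_point:
  assumes "b \<in> carrier S" "c \<in> carrier R" "v \<in> poly_values b c n"
  shows "b \<otimes>\<^bsub>S\<^esub> v \<in> poly_values b c (Suc n)"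
  using poly_values_SucI[OF assms(3) R.zero_closed] poly_values_closed[OF assms] assms(1) by simp

lemma poly_values_add:
  assumes b: "b \<in> carrier S" and c: "c \<in> carrier R" and d: "d \<in> carrier R"
  shows "v \<in> poly_values b c n \<Longrightarrow> w \<in> poly_values b d n \<Longrightarrow>
    v \<oplus>\<^bsub>S\<^esub> w \<in> poly_values b (c \<oplus> d) n"
proof (induction n arbitrary: v w)
  case 0
  then show ?case using c d by simp
next
  case (Suc n)
  then obtain v' a w' a' where *: "v = b \<otimes>\<^bsub>S\<^esub> v' \<oplus>\<^bsub>S\<^esub> h a" "w = b \<otimes>\<^bsub>S\<^esub> w' \<oplus>\<^bsub>S\<^esub> h a'"
    "v' \<in> poly_values b c n" "w' \<in> poly_values b d n" "a \<in> carrier R" "a' \<in> carrier R"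
    by auto
  have cl: "v' \<in> carrier S" "w' \<in> carrier S"
    using * poly_values_closed b c d by auto
  have eq: "v \<oplus>\<^bsub>S\<^esub> w = b \<otimes>\<^bsub>S\<^esub> (v' \<oplus>\<^bsub>S\<^esub> w') \<oplus>\<^bsub>S\<^esub> h (a \<oplus> a')"
    using * cl b by (simp add: S.r_distr S.a_ac)
  show ?case
    unfolding eq using * by (intro poly_values_SucI Suc.IH) auto
qed

lemma poly_values_smult:
  assumes b: "b \<in> carrier S" and c: "c \<in> carrier R" and r: "r \<in> carrier R"
  shows "v \<in> poly_values b c n \<Longrightarrow> h r \<otimes>\<^bsub>S\<^esub> v \<in> poly_values b (r \<otimes> c) n"
proof (induction n arbitrary: v)
  case 0
  then show ?case using c r by simp
next
  case (Suc n)
  then obtain v' a where *: "v = b \<otimes>\<^bsub>S\<^esub> v' \<oplus>\<^bsub>S\<^esub> h a" "v' \<in> poly_values b c n" "a \<in> carrier R"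
    by auto
  have cl: "v' \<in> carrier S"
    using * poly_values_closed b c by auto
  have eq: "h r \<otimes>\<^bsub>S\<^esub> v = b \<otimes>\<^bsub>S\<^esub> (h r \<otimes>\<^bsub>S\<^esub> v') \<oplus>\<^bsub>S\<^esub> h (r \<otimes> a)"
    using * cl b r by (simp add: S.r_distr S.m_ac)
  show ?case
    unfolding eq using * r by (intro poly_values_SucI Suc.IH) auto
qed

text \<open>
  A polynomial of degree at most \<open>n\<close> has vanishing coefficients above \<open>n\<close>.
\<close>

lemma poly_values_raise:
  assumes b: "b \<in> carrier S" and c: "c \<in> carrier R"
  shows "v \<in> poly_values b c n \<Longrightarrow> n < m \<Longrightarrow> v \<in> poly_values b \<zero> m"
proof (induction n arbitrary: v m)
  case 0
  then obtain k where m: "m = Suc k" by (cases m) auto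
  have "\<zero>\<^bsub>S\<^esub> \<in> poly_values b \<zero> k"
  proof (induction k)
    case (Suc k)
    then show ?case using poly_values_times_point[OF b R.zero_closed Suc] b by simp
  qed simp
  from poly_values_SucI[OF this c] show ?case using 0 m b c by simp
next
  case (Suc n)
  then obtain k where m: "m = Suc k" by (cases m) auto
  then show ?case using Suc by auto
qed

text \<open>
  The Horner step for the first factor turns \<open>(b v' + a) w\<close> into \<open>b (v' w) + a w\<close>, where the second
  summand has too low a degree to affect the leading coefficient.
\<close>

lemma poly_values_mult:
  assumes b: "b \<in> carrier S" and c: "c \<in> carrier R" and d: "d \<in> carrier R"
    and w: "w \<in> poly_values b d n"
  shows "v \<in> poly_values b c m \<Longrightarrow> v \<otimes>\<^bsub>S\<^esub> w \<in> poly_values b (c \<otimes> d) (m + n)"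
proof (induction m arbitrary: v)
  case 0
  then show ?case using poly_values_smult[OF b d c w] by simp
next
  case (Suc m)
  then obtain v' a where *: "v = b \<otimes>\<^bsub>S\<^esub> v' \<oplus>\<^bsub>S\<^esub> h a" "v' \<in> poly_values b c m" "a \<in> carrier R"
    by auto
  have cl: "v' \<in> carrier S" "w \<in> carrier S"
    using * poly_values_closed b c d w by auto
  have eq: "v \<otimes>\<^bsub>S\<^esub> w = b \<otimes>\<^bsub>S\<^esub> (v' \<otimes>\<^bsub>S\<^esub> w) \<oplus>\<^bsub>S\<^esub> h a \<otimes>\<^bsub>S\<^esub> w"
    using * cl b by (simp add: S.l_distr S.m_assoc)
  have 1: "b \<otimes>\<^bsub>S\<^esub> (v' \<otimes>\<^bsub>S\<^esub> w) \<in> poly_values b (c \<otimes> d) (Suc (m + n))"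
    using poly_values_times_point[OF b _ Suc.IH[OF *(2)]] c d by simp
  have "h a \<otimes>\<^bsub>S\<^esub> w \<in> poly_values b (a \<otimes> d) n"
    using poly_values_smult[OF b d *(3) w] .
  then have 2: "h a \<otimes>\<^bsub>S\<^esub> w \<in> poly_values b \<zero> (Suc (m + n))"
    using poly_values_raise[OF b, of "a \<otimes> d" _ n "Suc (m+n)"] * d by simp
  show ?case
    using poly_values_add[OF b _ _ 1 2] c d by (simp add: eq)
qed

lemma poly_values_minus:
  assumes b: "b \<in> carrier S" and c: "c \<in> carrier R" and d: "d \<in> carrier R"
    and v: "v \<in> poly_values b c n" and w: "w \<in> poly_values b d n"
  shows "v \<ominus>\<^bsub>S\<^esub> w \<in> poly_values b (c \<ominus> d) n"
proof -
  have "h (\<ominus> \<one>) \<otimes>\<^bsub>S\<^esub> w = \<ominus>\<^bsub>S\<^esub> w"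
    using poly_values_closed[OF b d w] by (simp add: S.l_minus)
  then have "\<ominus>\<^bsub>S\<^esub> w \<in> poly_values b (\<ominus> d) n"
    using poly_values_smult[OF b d _ w, of "\<ominus> \<one>"] d by (simp add: R.l_minus)
  from poly_values_add[OF b c _ v this] d show ?thesis
    by (simp add: R.minus_eq S.minus_eq)
qed

text \<open>
  The Horner scheme and the sum of the coefficients times powers of \<open>b\<close> agree: splitting off the
  constant term of the sum leaves \<open>b\<close> times a sum of the same form.
\<close>

lemma poly_values_eq_sums:
  assumes b: "b \<in> carrier S" and c: "c \<in> carrier R"
  shows "v \<in> poly_values b c n \<longleftrightarrow> (\<exists>a. (\<forall>i\<le>n. a i \<in> carrier R) \<and> a n = c \<and>
      v = (\<Oplus>\<^bsub>S\<^esub>i\<in>{..n}. h (a i) \<otimes>\<^bsub>S\<^esub> b [^]\<^bsub>S\<^esub> i))"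
proof (induction n arbitrary: v)
  case 0
  have "(\<Oplus>\<^bsub>S\<^esub>i\<in>{..0}. h (a i) \<otimes>\<^bsub>S\<^esub> b [^]\<^bsub>S\<^esub> i) = h c"
    if "a 0 = c" for a :: "nat \<Rightarrow> 'a"
    using that c by simp
  then show ?case using c by (auto intro!: exI[of _ "\<lambda>_. c"])
next
  case (Suc n)
  have step: "(\<Oplus>\<^bsub>S\<^esub>i\<in>{..Suc n}. h (a i) \<otimes>\<^bsub>S\<^esub> b [^]\<^bsub>S\<^esub> i)
      = b \<otimes>\<^bsub>S\<^esub> (\<Oplus>\<^bsub>S\<^esub>i\<in>{..n}. h (a (Suc i)) \<otimes>\<^bsub>S\<^esub> b [^]\<^bsub>S\<^esub> i) \<oplus>\<^bsub>S\<^esub> h (a 0)"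
    if a: "\<forall>i\<le>Suc n. a i \<in> carrier R" for a :: "nat \<Rightarrow> 'a"
  proof -
    have "(\<Oplus>\<^bsub>S\<^esub>i\<in>{..Suc n}. h (a i) \<otimes>\<^bsub>S\<^esub> b [^]\<^bsub>S\<^esub> i)
      = (\<Oplus>\<^bsub>S\<^esub>i\<in>{..n}. h (a (Suc i)) \<otimes>\<^bsub>S\<^esub> b [^]\<^bsub>S\<^esub> Suc i) \<oplus>\<^bsub>S\<^esub> h (a 0) \<otimes>\<^bsub>S\<^esub> b [^]\<^bsub>S\<^esub> (0::nat)"
      using a b by (intro S.finsum_Suc2) auto
    also have "(\<Oplus>\<^bsub>S\<^esub>i\<in>{..n}. h (a (Suc i)) \<otimes>\<^bsub>S\<^esub> b [^]\<^bsub>S\<^esub> Suc i)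
      = (\<Oplus>\<^bsub>S\<^esub>i\<in>{..n}. b \<otimes>\<^bsub>S\<^esub> (h (a (Suc i)) \<otimes>\<^bsub>S\<^esub> b [^]\<^bsub>S\<^esub> i))"
      using a b by (intro S.finsum_cong') (auto simp: S.m_ac)
    also have "\<dots> = b \<otimes>\<^bsub>S\<^esub> (\<Oplus>\<^bsub>S\<^esub>i\<in>{..n}. h (a (Suc i)) \<otimes>\<^bsub>S\<^esub> b [^]\<^bsub>S\<^esub> i)"
      using a b by (intro S.finsum_rdistr[symmetric]) auto
    finally show ?thesis using a b by simp
  qed
  show ?case
  proof
    assume "v \<in> poly_values b c (Suc n)"
    then obtain v' r where v: "v = b \<otimes>\<^bsub>S\<^esub> v' \<oplus>\<^bsub>S\<^esub> h r" "v' \<in> poly_values b c n" "r \<in> carrier R"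
      by auto
    from v(2) Suc.IH obtain a where a: "\<forall>i\<le>n. a i \<in> carrier R" "a n = c"
      "v' = (\<Oplus>\<^bsub>S\<^esub>i\<in>{..n}. h (a i) \<otimes>\<^bsub>S\<^esub> b [^]\<^bsub>S\<^esub> i)" by blast
    let ?a = "case_nat r a"
    have "\<forall>i\<le>Suc n. ?a i \<in> carrier R" using a v by (auto split: nat.split)
    then show "\<exists>a. (\<forall>i\<le>Suc n. a i \<in> carrier R) \<and> a (Suc n) = c \<and>
        v = (\<Oplus>\<^bsub>S\<^esub>i\<in>{..Suc n}. h (a i) \<otimes>\<^bsub>S\<^esub> b [^]\<^bsub>S\<^esub> i)"
      using step[of ?a] a v by (intro exI[of _ ?a]) simp
  next
    assume "\<exists>a. (\<forall>i\<le>Suc n. a i \<in> carrier R) \<and> a (Suc n) = c \<and>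
        v = (\<Oplus>\<^bsub>S\<^esub>i\<in>{..Suc n}. h (a i) \<otimes>\<^bsub>S\<^esub> b [^]\<^bsub>S\<^esub> i)"
    then obtain a where a: "\<forall>i\<le>Suc n. a i \<in> carrier R" "a (Suc n) = c"
      "v = (\<Oplus>\<^bsub>S\<^esub>i\<in>{..Suc n}. h (a i) \<otimes>\<^bsub>S\<^esub> b [^]\<^bsub>S\<^esub> i)" by blast
    have "(\<Oplus>\<^bsub>S\<^esub>i\<in>{..n}. h (a (Suc i)) \<otimes>\<^bsub>S\<^esub> b [^]\<^bsub>S\<^esub> i) \<in> poly_values b c n"
      unfolding Suc.IH using a by (intro exI[of _ "\<lambda>i. a (Suc i)"]) auto
    then show "v \<in> poly_values b c (Suc n)"
      unfolding a(3) step[OF a(1)] using a(1) by (intro poly_values_SucI) auto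
  qed
qed

lemma integral_over_iff:
  assumes b: "b \<in> carrier S"
  shows "integral_over R S h b \<longleftrightarrow> (\<exists>n. \<zero>\<^bsub>S\<^esub> \<in> poly_values b \<one> n)"
proof
  interpret UP_cring R "UP R" by unfold_locales simp
  assume "integral_over R S h b"
  then obtain p where p: "p \<in> carrier (UP R)" "coeff (UP R) p (deg R p) = \<one>" "eval R S h b p = \<zero>\<^bsub>S\<^esub>"
    unfolding integral_over_def UP_monic_def by blast
  have "\<zero>\<^bsub>S\<^esub> \<in> poly_values b \<one> (deg R p)"
    unfolding poly_values_eq_sums[OF b R.one_closed] using p eval_on_carrier[OF p(1), of S h b]
    by (intro exI[of _ "coeff (UP R) p"]) simp
  then show "\<exists>n. \<zero>\<^bsub>S\<^esub> \<in> poly_values b \<one> n" ..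
next
  interpret UP_cring R "UP R" by unfold_locales simp
  assume "\<exists>n. \<zero>\<^bsub>S\<^esub> \<in> poly_values b \<one> n"
  then obtain n where n: "\<zero>\<^bsub>S\<^esub> \<in> poly_values b \<one> n" by (elim exE)
  then obtain a where a: "\<forall>i\<le>n. a i \<in> carrier R" "a n = \<one>"
    "\<zero>\<^bsub>S\<^esub> = (\<Oplus>\<^bsub>S\<^esub>i\<in>{..n}. h (a i) \<otimes>\<^bsub>S\<^esub> b [^]\<^bsub>S\<^esub> i)"
    by (auto dest!: iffD1[OF poly_values_eq_sums[OF b R.one_closed]])
  show "integral_over R S h b"
  \<comment> \<open>In the zero ring every polynomial has degree 0, so the degree argument below is not available.\<close>
  proof (cases "\<one> = \<zero>")
    case True
    have "UP_monic R \<zero>\<^bsub>UP R\<^esub>" unfolding UP_monic_def using True by simp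
    moreover have "eval R S h b \<zero>\<^bsub>UP R\<^esub> = \<zero>\<^bsub>S\<^esub>"
      using eval_on_carrier[OF UP_zero_closed, of S h b] b by simp
    ultimately show ?thesis unfolding integral_over_def by blast
  next
    case False
    define p where "p = (\<lambda>i. if i \<le> n then a i else \<zero>)"
    have up: "p \<in> up R" unfolding p_def using a by (auto intro!: mem_upI exI[of _ n] bound.intro)
    then have P: "p \<in> carrier (UP R)" by (simp add: UP_def)
    have cf: "coeff (UP R) p i = (if i \<le> n then a i else \<zero>)" for i
      using up by (simp add: UP_def p_def)
    have "deg R p \<le> n" using P cf by (intro deg_aboveI) auto
    moreover have "n \<le> deg R p" using P cf a False by (intro deg_belowI) auto
    ultimately have deg: "deg R p = n" by simp
    have "eval R S h b p = (\<Oplus>\<^bsub>S\<^esub>i\<in>{..n}. h (a i) \<otimes>\<^bsub>S\<^esub> b [^]\<^bsub>S\<^esub> i)"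
      unfolding eval_on_carrier[OF P] deg using a b cf by (intro S.finsum_cong') auto
    then show ?thesis
      unfolding integral_over_def UP_monic_def using P deg cf a by (intro exI[of _ p]) simp
  qed
qed

end

section \<open>Finite extensions are integral\<close>

context ring_hom_cring
begin

text \<open>
  Division-free Gaussian elimination of the last unknown. Multiply row \<open>i\<close> by the last diagonal entry
  and subtract \<open>D i (n + 1)\<close> times the last row. Products of two diagonal entries are monic of degree
  \<open>2 d\<close>, whereas all other products that occur have an off-diagonal factor and hence degree less
  than \<open>2 d\<close>. So the new system has the same shape.
\<close>

lemma monic_annihilator_of_linear_system:
  assumes b: "b \<in> carrier S"
  shows "\<lbrakk>\<And>j. j \<le> n \<Longrightarrow> m j \<in> carrier S;
     \<And>i j. i \<le> n \<Longrightarrow> j \<le> n \<Longrightarrow> D i j \<in> poly_values b (if i = j then \<one> else \<zero>) d;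
     \<And>i. i \<le> n \<Longrightarrow> (\<Oplus>\<^bsub>S\<^esub>j\<in>{..n}. D i j \<otimes>\<^bsub>S\<^esub> m j) = \<zero>\<^bsub>S\<^esub>\<rbrakk>
    \<Longrightarrow> \<exists>e. \<exists>v\<in>poly_values b \<one> e. v \<otimes>\<^bsub>S\<^esub> m (0::nat) = \<zero>\<^bsub>S\<^esub>"
proof (induction n arbitrary: d D)
  case 0
  have v: "D 0 0 \<in> poly_values b \<one> d" using 0(2)[of 0 0] by simp
  then have "D 0 0 \<otimes>\<^bsub>S\<^esub> m 0 = \<zero>\<^bsub>S\<^esub>"
    using 0(1)[of 0] 0(3)[of 0] poly_values_closed[OF b R.one_closed v]
    by (simp add: S.finsum_singleton)
  then show ?case using v by blast
next
  case (Suc n)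
  let ?N = "Suc n"
  let ?E = "\<lambda>i j. D ?N ?N \<otimes>\<^bsub>S\<^esub> D i j \<ominus>\<^bsub>S\<^esub> D i ?N \<otimes>\<^bsub>S\<^esub> D ?N j"
  have D: "D i j \<in> carrier S" if "i \<le> ?N" "j \<le> ?N" for i j
    using Suc.prems(2)[OF that] poly_values_closed[OF b, of "if i = j then \<one> else \<zero>"] by auto
  show ?case
  proof (rule Suc.IH[of ?E "d + d"])
    fix j assume "j \<le> n" then show "m j \<in> carrier S" using Suc.prems(1) by simp
  next
    fix i j assume ij: "i \<le> n" "j \<le> n"
    have 1: "D ?N ?N \<otimes>\<^bsub>S\<^esub> D i j \<in> poly_values b (\<one> \<otimes> (if i = j then \<one> else \<zero>)) (d + d)"
      using poly_values_mult[OF b _ _ Suc.prems(2)[of i j], of \<one>] Suc.prems(2)[of ?N ?N] ij by auto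
    have 2: "D i ?N \<otimes>\<^bsub>S\<^esub> D ?N j \<in> poly_values b (\<zero> \<otimes> \<zero>) (d + d)"
      using poly_values_mult[OF b, of \<zero> \<zero> "D ?N j" d "D i ?N" d]
        Suc.prems(2)[of ?N j] Suc.prems(2)[of i ?N] ij by simp
    show "?E i j \<in> poly_values b (if i = j then \<one> else \<zero>) (d + d)"
      using poly_values_minus[OF b _ _ 1 2] by (cases "i = j") (simp_all add: R.minus_eq)
  next
    fix i assume i: "i \<le> n"
    have m: "m j \<in> carrier S" if "j \<le> ?N" for j using Suc.prems(1) that .
    have row: "(\<Oplus>\<^bsub>S\<^esub>j\<in>{..n}. D i j \<otimes>\<^bsub>S\<^esub> m j) = \<ominus>\<^bsub>S\<^esub> (D i ?N \<otimes>\<^bsub>S\<^esub> m ?N)" if "i \<le> ?N" for i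
    proof -
      have "D i ?N \<otimes>\<^bsub>S\<^esub> m ?N \<oplus>\<^bsub>S\<^esub> (\<Oplus>\<^bsub>S\<^esub>j\<in>{..n}. D i j \<otimes>\<^bsub>S\<^esub> m j) = \<zero>\<^bsub>S\<^esub>"
        using Suc.prems(3)[OF that] D m that by (subst (asm) S.finsum_Suc) auto
      then show ?thesis
        using D m that by (intro S.sum_zero_eq_neg) (auto simp: S.a_comm intro!: S.finsum_closed)
    qed
    have "(\<Oplus>\<^bsub>S\<^esub>j\<in>{..n}. ?E i j \<otimes>\<^bsub>S\<^esub> m j)
      = (\<Oplus>\<^bsub>S\<^esub>j\<in>{..n}. D ?N ?N \<otimes>\<^bsub>S\<^esub> (D i j \<otimes>\<^bsub>S\<^esub> m j) \<oplus>\<^bsub>S\<^esub> (\<ominus>\<^bsub>S\<^esub> D i ?N) \<otimes>\<^bsub>S\<^esub> (D ?N j \<otimes>\<^bsub>S\<^esub> m j))"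
      using D m i by (intro S.finsum_cong') 
        (auto simp: S.minus_eq S.l_distr S.m_assoc S.l_minus)
    also have "\<dots> = (\<Oplus>\<^bsub>S\<^esub>j\<in>{..n}. D ?N ?N \<otimes>\<^bsub>S\<^esub> (D i j \<otimes>\<^bsub>S\<^esub> m j))
        \<oplus>\<^bsub>S\<^esub> (\<Oplus>\<^bsub>S\<^esub>j\<in>{..n}. (\<ominus>\<^bsub>S\<^esub> D i ?N) \<otimes>\<^bsub>S\<^esub> (D ?N j \<otimes>\<^bsub>S\<^esub> m j))"
      using D m i by (intro S.finsum_addf) auto
    also have "\<dots> = D ?N ?N \<otimes>\<^bsub>S\<^esub> (\<Oplus>\<^bsub>S\<^esub>j\<in>{..n}. D i j \<otimes>\<^bsub>S\<^esub> m j)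
        \<oplus>\<^bsub>S\<^esub> (\<ominus>\<^bsub>S\<^esub> D i ?N) \<otimes>\<^bsub>S\<^esub> (\<Oplus>\<^bsub>S\<^esub>j\<in>{..n}. D ?N j \<otimes>\<^bsub>S\<^esub> m j)"
      using D m i by (subst (1 2) S.finsum_rdistr) auto
    also have "\<dots> = \<zero>\<^bsub>S\<^esub>"
      using D m i by (simp add: row S.l_minus S.r_minus S.m_ac S.l_neg)
    finally show "(\<Oplus>\<^bsub>S\<^esub>j\<in>{..n}. ?E i j \<otimes>\<^bsub>S\<^esub> m j) = \<zero>\<^bsub>S\<^esub>" .
  qed
qed

text \<open>
  Write each \<open>b m\<^sub>i\<close> in terms of the generators. The elements \<open>b \<delta>\<^sub>i\<^sub>j - a\<^sub>i\<^sub>j\<close> are then the coefficients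
  of a linear system solved by the generators, with \<open>d = 1\<close>. Elimination produces a monic value at \<open>b\<close>
  that annihilates \<open>m\<^sub>0 = 1\<close> and is therefore zero.
\<close>

lemma finite_imp_integral:
  assumes b: "b \<in> carrier S"
    and m: "\<And>j. j \<le> n \<Longrightarrow> m j \<in> carrier S" and m0: "m (0::nat) = \<one>\<^bsub>S\<^esub>"
    and span: "\<And>y. y \<in> carrier S \<Longrightarrow>
      \<exists>a. (\<forall>j\<le>n. a j \<in> carrier R) \<and> y = (\<Oplus>\<^bsub>S\<^esub>j\<in>{..n}. h (a j) \<otimes>\<^bsub>S\<^esub> m j)"
  shows "\<exists>e. \<zero>\<^bsub>S\<^esub> \<in> poly_values b \<one> e"
proof -
  have "\<forall>i. \<exists>a. i \<le> n \<longrightarrow>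
      (\<forall>j\<le>n. a j \<in> carrier R) \<and> b \<otimes>\<^bsub>S\<^esub> m i = (\<Oplus>\<^bsub>S\<^esub>j\<in>{..n}. h (a j) \<otimes>\<^bsub>S\<^esub> m j)"
    using span b m by (metis S.m_closed)
  then obtain a where a: "\<And>i j. i \<le> n \<Longrightarrow> j \<le> n \<Longrightarrow> a i j \<in> carrier R"
    and bm: "\<And>i. i \<le> n \<Longrightarrow> b \<otimes>\<^bsub>S\<^esub> m i = (\<Oplus>\<^bsub>S\<^esub>j\<in>{..n}. h (a i j) \<otimes>\<^bsub>S\<^esub> m j)"
    by metis
  let ?D = "\<lambda>i j. b \<otimes>\<^bsub>S\<^esub> h (if i = j then \<one> else \<zero>) \<oplus>\<^bsub>S\<^esub> h (\<ominus> a i j)"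
  have "\<exists>e. \<exists>v\<in>poly_values b \<one> e. v \<otimes>\<^bsub>S\<^esub> m 0 = \<zero>\<^bsub>S\<^esub>"
  proof (rule monic_annihilator_of_linear_system[OF b, of n m ?D 1])
    fix i j assume "i \<le> n" "j \<le> n"
    then show "?D i j \<in> poly_values b (if i = j then \<one> else \<zero>) 1"
      unfolding One_nat_def using a by (intro poly_values_SucI) auto
  next
    fix i assume i: "i \<le> n"
    have "(\<Oplus>\<^bsub>S\<^esub>j\<in>{..n}. ?D i j \<otimes>\<^bsub>S\<^esub> m j)
      = (\<Oplus>\<^bsub>S\<^esub>j\<in>{..n}. (if i = j then b \<otimes>\<^bsub>S\<^esub> m j else \<zero>\<^bsub>S\<^esub>)
          \<oplus>\<^bsub>S\<^esub> (\<ominus>\<^bsub>S\<^esub> \<one>\<^bsub>S\<^esub>) \<otimes>\<^bsub>S\<^esub> (h (a i j) \<otimes>\<^bsub>S\<^esub> m j))"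
      using a m b i by (intro S.finsum_cong') (auto simp: S.l_distr S.l_minus)
    also have "\<dots> = (\<Oplus>\<^bsub>S\<^esub>j\<in>{..n}. if i = j then b \<otimes>\<^bsub>S\<^esub> m j else \<zero>\<^bsub>S\<^esub>)
       \<oplus>\<^bsub>S\<^esub> (\<Oplus>\<^bsub>S\<^esub>j\<in>{..n}. (\<ominus>\<^bsub>S\<^esub> \<one>\<^bsub>S\<^esub>) \<otimes>\<^bsub>S\<^esub> (h (a i j) \<otimes>\<^bsub>S\<^esub> m j))"
      using a m b i by (intro S.finsum_addf) auto
    also have "(\<Oplus>\<^bsub>S\<^esub>j\<in>{..n}. if i = j then b \<otimes>\<^bsub>S\<^esub> m j else \<zero>\<^bsub>S\<^esub>) = b \<otimes>\<^bsub>S\<^esub> m i"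
      using b m i by (intro S.finsum_singleton) auto
    also have "(\<Oplus>\<^bsub>S\<^esub>j\<in>{..n}. (\<ominus>\<^bsub>S\<^esub> \<one>\<^bsub>S\<^esub>) \<otimes>\<^bsub>S\<^esub> (h (a i j) \<otimes>\<^bsub>S\<^esub> m j))
       = (\<ominus>\<^bsub>S\<^esub> \<one>\<^bsub>S\<^esub>) \<otimes>\<^bsub>S\<^esub> (b \<otimes>\<^bsub>S\<^esub> m i)"
      unfolding bm[OF i] using a m i by (intro S.finsum_rdistr[symmetric]) auto
    also have "b \<otimes>\<^bsub>S\<^esub> m i \<oplus>\<^bsub>S\<^esub> (\<ominus>\<^bsub>S\<^esub> \<one>\<^bsub>S\<^esub>) \<otimes>\<^bsub>S\<^esub> (b \<otimes>\<^bsub>S\<^esub> m i) = \<zero>\<^bsub>S\<^esub>"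
      using b m i by (simp add: S.l_minus S.r_neg)
    finally show "(\<Oplus>\<^bsub>S\<^esub>j\<in>{..n}. ?D i j \<otimes>\<^bsub>S\<^esub> m j) = \<zero>\<^bsub>S\<^esub>" .
  qed (use m in auto)
  then show ?thesis
    using poly_values_closed[OF b R.one_closed] by (auto simp: m0)
qed

end

theorem integral_extension_tower:
  assumes AB: "ring_extension A B h" and BC: "ring_extension B C g"
    and AC: "integral_extension A C (g \<circ> h)"
  shows "integral_extension A B h" and "integral_extension B C g"
proof -
  interpret AB: ring_hom_cring A B h using AB unfolding ring_extension_def by blast
  interpret BC: ring_hom_cring B C g using BC unfolding ring_extension_def by blast
  interpret AC: ring_hom_cring A C "g \<circ> h"
    using AC unfolding integral_extension_def ring_extension_def by blast
  have inj: "inj_on g (carrier B)" using BC unfolding ring_extension_def by blast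
  have int: "\<exists>n. \<zero>\<^bsub>C\<^esub> \<in> AC.poly_values y \<one>\<^bsub>A\<^esub> n" if "y \<in> carrier C" for y
    using AC AC.integral_over_iff[OF that] that unfolding integral_extension_def by blast
  \<comment> \<open>The Horner scheme commutes with \<open>g\<close>, so a monic value at \<open>g b\<close> comes from the same monic value at \<open>b\<close>.\<close>
  have down: "AC.poly_values (g b) \<one>\<^bsub>A\<^esub> n \<subseteq> g ` AB.poly_values b \<one>\<^bsub>A\<^esub> n"
    if b: "b \<in> carrier B" for b n
  proof (induction n)
    case 0
    show ?case unfolding AC.poly_values.simps(1) AB.poly_values.simps(1) by simp
  next
    case (Suc n)
    show ?case
    proof
      fix v assume "v \<in> AC.poly_values (g b) \<one>\<^bsub>A\<^esub> (Suc n)"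
      then obtain w a where v: "v = g b \<otimes>\<^bsub>C\<^esub> w \<oplus>\<^bsub>C\<^esub> g (h a)" "w \<in> AC.poly_values (g b) \<one>\<^bsub>A\<^esub> n" "a \<in> carrier A"
        by auto
      then obtain u where u: "u \<in> AB.poly_values b \<one>\<^bsub>A\<^esub> n" "w = g u" using Suc.IH by blast
      then have "u \<in> carrier B" using AB.poly_values_closed[OF b] by blast
      then have "v = g (b \<otimes>\<^bsub>B\<^esub> u \<oplus>\<^bsub>B\<^esub> h a)" using v u b by simp
      then show "v \<in> g ` AB.poly_values b \<one>\<^bsub>A\<^esub> (Suc n)"
        using AB.poly_values_SucI[OF u(1) v(3)] by (rule image_eqI)
    qed
  qed
  \<comment> \<open>A polynomial with coefficients in \<open>A\<close> may be read as one with coefficients in \<open>B\<close>.\<close>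
  have up: "AC.poly_values y \<one>\<^bsub>A\<^esub> n \<subseteq> BC.poly_values y \<one>\<^bsub>B\<^esub> n" for y n
  proof (induction n)
    case 0
    show ?case unfolding AC.poly_values.simps(1) BC.poly_values.simps(1) by simp
  next
    case (Suc n)
    show ?case
    proof
      fix v assume "v \<in> AC.poly_values y \<one>\<^bsub>A\<^esub> (Suc n)"
      then obtain w a where v: "v = y \<otimes>\<^bsub>C\<^esub> w \<oplus>\<^bsub>C\<^esub> g (h a)" "w \<in> AC.poly_values y \<one>\<^bsub>A\<^esub> n" "a \<in> carrier A"
        by auto
      show "v \<in> BC.poly_values y \<one>\<^bsub>B\<^esub> (Suc n)"
        unfolding v(1)
        using subsetD[OF Suc.IH v(2)] AB.hom_closed[OF v(3)] by (rule BC.poly_values_SucI)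
    qed
  qed
  show "integral_extension A B h"
    unfolding integral_extension_def
  proof (intro conjI ballI AB)
    fix b assume b: "b \<in> carrier B"
    then obtain n where "\<zero>\<^bsub>C\<^esub> \<in> AC.poly_values (g b) \<one>\<^bsub>A\<^esub> n" using int[of "g b"] by auto
    then obtain v where v: "v \<in> AB.poly_values b \<one>\<^bsub>A\<^esub> n" "g v = g \<zero>\<^bsub>B\<^esub>" using down[OF b, of n] by auto
    then have "v = \<zero>\<^bsub>B\<^esub>" using inj_onD[OF inj] AB.poly_values_closed[OF b _ v(1)] by auto
    then show "integral_over A B h b" using AB.integral_over_iff[OF b] v by blast
  qed
  show "integral_extension B C g"
    unfolding integral_extension_def
  proof (intro conjI ballI BC)
    fix y assume y: "y \<in> carrier C"
    then show "integral_over B C g y" using int[OF y] up BC.integral_over_iff[OF y] by blast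
  qed
qed

section \<open>Primes in integral extensions\<close>

context ring_hom_cring
begin

text \<open>
  Suppose \<open>s = x b\<close> modulo \<open>Q\<close>. Multiplying the value at \<open>b\<close> of a monic polynomial of degree \<open>n\<close> by
  \<open>x\<^sup>n\<close> replaces each \<open>(x b)\<^sup>i\<close> by \<open>s\<^sup>i\<close>, and all terms but the leading one keep a factor \<open>x\<close>. If \<open>b\<close> is
  integral, this gives an element \<open>s\<^sup>n + x c\<close> of \<open>R\<close> that lies in \<open>Q\<close>.
\<close>

lemma power_mod_ideal_of_monic_value:
  assumes b: "b \<in> carrier S" and x: "x \<in> carrier R" and s: "s \<in> carrier R"
    and Q: "ideal Q S" and eq: "h s \<ominus>\<^bsub>S\<^esub> h x \<otimes>\<^bsub>S\<^esub> b \<in> Q"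
  shows "v \<in> poly_values b \<one> n \<Longrightarrow>
    \<exists>c\<in>carrier R. h (s [^] n \<oplus> x \<otimes> c) \<ominus>\<^bsub>S\<^esub> h (x [^] n) \<otimes>\<^bsub>S\<^esub> v \<in> Q"
proof (induction n arbitrary: v)
  case 0
  interpret Q: ideal Q S by fact
  show ?case using 0 x by (intro bexI[of _ \<zero>]) (simp_all add: S.minus_eq S.r_neg)
next
  case (Suc n)
  interpret Q: ideal Q S by fact
  from Suc.prems obtain w a where v: "v = b \<otimes>\<^bsub>S\<^esub> w \<oplus>\<^bsub>S\<^esub> h a" "w \<in> poly_values b \<one> n" "a \<in> carrier R"
    by auto
  then have w: "w \<in> carrier S" using poly_values_closed b by blast
  from Suc.IH[OF v(2)] obtain c where c: "c \<in> carrier R"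
    and IH: "h (s [^] n \<oplus> x \<otimes> c) \<ominus>\<^bsub>S\<^esub> h (x [^] n) \<otimes>\<^bsub>S\<^esub> w \<in> Q" by blast
  let ?u = "h (s [^] n \<oplus> x \<otimes> c)" and ?y = "h (x [^] n)"
  have cl: "?u \<in> carrier S" "?y \<in> carrier S" "h s \<in> carrier S" "h x \<in> carrier S" "h a \<in> carrier S"
    using x s c v by auto
  have "h s \<otimes>\<^bsub>S\<^esub> (?u \<ominus>\<^bsub>S\<^esub> ?y \<otimes>\<^bsub>S\<^esub> w) \<oplus>\<^bsub>S\<^esub> (?y \<otimes>\<^bsub>S\<^esub> w) \<otimes>\<^bsub>S\<^esub> (h s \<ominus>\<^bsub>S\<^esub> h x \<otimes>\<^bsub>S\<^esub> b) \<in> Q"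
    using cl w by (intro Q.a_closed Q.I_l_closed IH eq) auto
  also have "h s \<otimes>\<^bsub>S\<^esub> (?u \<ominus>\<^bsub>S\<^esub> ?y \<otimes>\<^bsub>S\<^esub> w) \<oplus>\<^bsub>S\<^esub> (?y \<otimes>\<^bsub>S\<^esub> w) \<otimes>\<^bsub>S\<^esub> (h s \<ominus>\<^bsub>S\<^esub> h x \<otimes>\<^bsub>S\<^esub> b)
     = (h s \<otimes>\<^bsub>S\<^esub> ?u \<oplus>\<^bsub>S\<^esub> h x \<otimes>\<^bsub>S\<^esub> (?y \<otimes>\<^bsub>S\<^esub> h a)) \<ominus>\<^bsub>S\<^esub> (h x \<otimes>\<^bsub>S\<^esub> ?y) \<otimes>\<^bsub>S\<^esub> v"
    using cl w b unfolding v(1) by algebra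
  also have "h s \<otimes>\<^bsub>S\<^esub> ?u \<oplus>\<^bsub>S\<^esub> h x \<otimes>\<^bsub>S\<^esub> (?y \<otimes>\<^bsub>S\<^esub> h a)
    = h (s [^] Suc n \<oplus> x \<otimes> (s \<otimes> c \<oplus> x [^] n \<otimes> a))"
    using x s c v(3) cl 
    by (simp add: S.r_distr S.l_distr S.m_ac S.a_ac del: hom_pow)
  also have "h x \<otimes>\<^bsub>S\<^esub> ?y = h (x [^] Suc n)"
    using x by (simp add: S.m_comm)
  finally show ?case using s c x v(3)
    by (intro bexI[of _ "s \<otimes> c \<oplus> x [^] n \<otimes> a"]) auto
qed

lemma contraction_prime:
  assumes "primeideal Q S"
  shows "primeideal {r \<in> carrier R. h r \<in> Q} R"
  using ring.primeideal_vimage[OF R.is_cring assms] .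

text \<open>
  This contains both lying over and going up: \<open>J\<close> is the zero ideal for the former and the
  preceding prime of a chain for the latter. Among the ideals above \<open>J\<close> whose contraction stays in
  \<open>P\<close>, Zorn's lemma gives a maximal one \<open>Q\<close>. For \<open>x\<close> outside \<open>Q\<close>, the ideal \<open>Q + (x)\<close> must contain the
  image of an element outside \<open>P\<close>. As the complement of \<open>P\<close> is multiplicatively closed, \<open>Q\<close> is
  prime. Were \<open>x\<close> in \<open>P\<close> but its image outside \<open>Q\<close>, then some \<open>s\<close> outside \<open>P\<close> would be congruent
  to \<open>x b\<close> modulo \<open>Q\<close>, and integrality of \<open>b\<close> would force a power of \<open>s\<close>, hence \<open>s\<close>, into \<open>P\<close>.
\<close>

lemma lying_over:
  assumes int: "\<And>b. b \<in> carrier S \<Longrightarrow> \<exists>n. \<zero>\<^bsub>S\<^esub> \<in> poly_values b \<one> n"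
    and P: "primeideal P R" and J: "ideal J S" and JP: "{r \<in> carrier R. h r \<in> J} \<subseteq> P"
  shows "\<exists>Q. primeideal Q S \<and> J \<subseteq> Q \<and> {r \<in> carrier R. h r \<in> Q} = P"
proof -
  interpret P: primeideal P R by fact
  let ?Z = "{K. ideal K S \<and> J \<subseteq> K \<and> {r \<in> carrier R. h r \<in> K} \<subseteq> P}"
  have "\<exists>Q\<in>?Z. \<forall>X\<in>?Z. Q \<subseteq> X \<longrightarrow> X = Q"
  proof (rule subset_Zorn_nonempty)
    show "?Z \<noteq> {}" using J JP by blast
  next
    fix C assume C: "C \<noteq> {}" "subset.chain ?Z C"
    have sub: "\<And>K. K \<in> C \<Longrightarrow> J \<subseteq> K \<and> {r \<in> carrier R. h r \<in> K} \<subseteq> P"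
      and "subset.chain {K. ideal K S} C"
      using C(2) unfolding subset.chain_def by auto
    then have "ideal (\<Union>C) S" using S.chain_Union_is_ideal[of C] C(1) by simp
    moreover have "J \<subseteq> \<Union>C" using sub C(1) by (meson ex_in_conv Sup_upper2)
    moreover have "{r \<in> carrier R. h r \<in> \<Union>C} \<subseteq> P" using sub by fast
    ultimately show "\<Union>C \<in> ?Z" by simp
  qed
  then obtain Q where Q: "ideal Q S" and JQ: "J \<subseteq> Q" and QP: "{r \<in> carrier R. h r \<in> Q} \<subseteq> P"
    and max: "\<And>K. ideal K S \<Longrightarrow> Q \<subseteq> K \<Longrightarrow> {r \<in> carrier R. h r \<in> K} \<subseteq> P \<Longrightarrow> K = Q"
    by (smt (verit) mem_Collect_eq order_trans)
  interpret Q: ideal Q S by fact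
  have enlarge: "\<exists>r\<in>carrier R. r \<notin> P \<and> (\<exists>c\<in>carrier S. h r \<ominus>\<^bsub>S\<^esub> x \<otimes>\<^bsub>S\<^esub> c \<in> Q)"
    if x: "x \<in> carrier S" "x \<notin> Q" for x
  proof (rule ccontr)
    assume neg: "\<not> ?thesis"
    let ?K = "Q <+>\<^bsub>S\<^esub> (PIdl\<^bsub>S\<^esub> x)"
    have K: "ideal ?K S" by (intro S.add_ideals Q S.cgenideal_ideal x)
    have memK: "y \<in> ?K \<longleftrightarrow> (\<exists>q\<in>Q. \<exists>c\<in>carrier S. y = q \<oplus>\<^bsub>S\<^esub> c \<otimes>\<^bsub>S\<^esub> x)" for y
      unfolding set_add_def' cgenideal_def by auto
    have "Q \<subseteq> ?K"
    proof
      fix q assume "q \<in> Q"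
      then show "q \<in> ?K" unfolding memK using x
        by (intro bexI[of _ q] bexI[of _ "\<zero>\<^bsub>S\<^esub>"]) (auto dest: Q.Icarr)
    qed
    moreover have "{r \<in> carrier R. h r \<in> ?K} \<subseteq> P"
    proof
      fix r assume "r \<in> {r \<in> carrier R. h r \<in> ?K}"
      then obtain q c where r: "r \<in> carrier R" "q \<in> Q" "c \<in> carrier S" "h r = q \<oplus>\<^bsub>S\<^esub> c \<otimes>\<^bsub>S\<^esub> x"
        unfolding memK by auto
      have "q \<oplus>\<^bsub>S\<^esub> c \<otimes>\<^bsub>S\<^esub> x \<ominus>\<^bsub>S\<^esub> x \<otimes>\<^bsub>S\<^esub> c = q"
        using Q.Icarr[OF r(2)] r(3) x by algebra
      then show "r \<in> P" using neg r by metis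
    qed
    ultimately have "?K = Q" using max[OF K] by blast
    moreover have "x \<in> ?K" unfolding memK using x
      by (intro bexI[of _ "\<zero>\<^bsub>S\<^esub>"] bexI[of _ "\<one>\<^bsub>S\<^esub>"]) auto
    ultimately show False using x by blast
  qed
  have "primeideal Q S"
  proof (rule primeidealI[OF Q])
    show "cring S" ..
    have "\<one> \<notin> P" using P.I_notcarr P.one_imp_carrier by auto
    then have "\<one>\<^bsub>S\<^esub> \<notin> Q" using QP by auto
    then show "carrier S \<noteq> Q" by auto
  next
    fix x y assume xy: "x \<in> carrier S" "y \<in> carrier S" "x \<otimes>\<^bsub>S\<^esub> y \<in> Q"
    show "x \<in> Q \<or> y \<in> Q"
    proof (rule ccontr)
      assume "\<not> ?thesis"
      with enlarge xy obtain r c r' c' where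
        r: "r \<in> carrier R" "r \<notin> P" "c \<in> carrier S" "h r \<ominus>\<^bsub>S\<^esub> x \<otimes>\<^bsub>S\<^esub> c \<in> Q" and
        r': "r' \<in> carrier R" "r' \<notin> P" "c' \<in> carrier S" "h r' \<ominus>\<^bsub>S\<^esub> y \<otimes>\<^bsub>S\<^esub> c' \<in> Q"
        by metis
      have cl: "h r \<in> carrier S" "h r' \<in> carrier S" using r r' by auto
      have "(h r \<ominus>\<^bsub>S\<^esub> x \<otimes>\<^bsub>S\<^esub> c) \<otimes>\<^bsub>S\<^esub> h r' \<in> Q"
        using r(4) cl(2) by (rule Q.I_r_closed)
      moreover have "(x \<otimes>\<^bsub>S\<^esub> c) \<otimes>\<^bsub>S\<^esub> (h r' \<ominus>\<^bsub>S\<^esub> y \<otimes>\<^bsub>S\<^esub> c') \<in> Q"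
        using r'(4) S.m_closed[OF xy(1) r(3)] by (rule Q.I_l_closed)
      moreover have "(c \<otimes>\<^bsub>S\<^esub> c') \<otimes>\<^bsub>S\<^esub> (x \<otimes>\<^bsub>S\<^esub> y) \<in> Q"
        using xy(3) S.m_closed[OF r(3) r'(3)] by (rule Q.I_l_closed)
      ultimately have "(h r \<ominus>\<^bsub>S\<^esub> x \<otimes>\<^bsub>S\<^esub> c) \<otimes>\<^bsub>S\<^esub> h r' \<oplus>\<^bsub>S\<^esub> (x \<otimes>\<^bsub>S\<^esub> c) \<otimes>\<^bsub>S\<^esub> (h r' \<ominus>\<^bsub>S\<^esub> y \<otimes>\<^bsub>S\<^esub> c')
        \<oplus>\<^bsub>S\<^esub> (c \<otimes>\<^bsub>S\<^esub> c') \<otimes>\<^bsub>S\<^esub> (x \<otimes>\<^bsub>S\<^esub> y) \<in> Q"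
        by (intro Q.a_closed)
      also have "(h r \<ominus>\<^bsub>S\<^esub> x \<otimes>\<^bsub>S\<^esub> c) \<otimes>\<^bsub>S\<^esub> h r' \<oplus>\<^bsub>S\<^esub> (x \<otimes>\<^bsub>S\<^esub> c) \<otimes>\<^bsub>S\<^esub> (h r' \<ominus>\<^bsub>S\<^esub> y \<otimes>\<^bsub>S\<^esub> c')
        \<oplus>\<^bsub>S\<^esub> (c \<otimes>\<^bsub>S\<^esub> c') \<otimes>\<^bsub>S\<^esub> (x \<otimes>\<^bsub>S\<^esub> y) = h r \<otimes>\<^bsub>S\<^esub> h r'"
        using cl xy r(3) r'(3) by algebra
      also have "\<dots> = h (r \<otimes> r')" using r r' by simp
      finally have "r \<otimes> r' \<in> P" using QP r r' by blast
      then show False using P.I_prime r r' by blast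
    qed
  qed
  moreover have "P \<subseteq> {r \<in> carrier R. h r \<in> Q}"
  proof (rule ccontr)
    assume "\<not> ?thesis"
    then obtain x where x: "x \<in> P" "x \<in> carrier R" "h x \<notin> Q" by (auto dest: P.Icarr)
    with enlarge[of "h x"] obtain s b where s: "s \<in> carrier R" "s \<notin> P"
      and b: "b \<in> carrier S" "h s \<ominus>\<^bsub>S\<^esub> h x \<otimes>\<^bsub>S\<^esub> b \<in> Q" by auto
    from int[OF b(1)] obtain n where "\<zero>\<^bsub>S\<^esub> \<in> poly_values b \<one> n" by blast
    from power_mod_ideal_of_monic_value[OF b(1) x(2) s(1) Q b(2) this] obtain c where c: "c \<in> carrier R"
      and "h (s [^] n \<oplus> x \<otimes> c) \<ominus>\<^bsub>S\<^esub> h (x [^] n) \<otimes>\<^bsub>S\<^esub> \<zero>\<^bsub>S\<^esub> \<in> Q" by blast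
    moreover have "z \<ominus>\<^bsub>S\<^esub> h (x [^] n) \<otimes>\<^bsub>S\<^esub> \<zero>\<^bsub>S\<^esub> = z" if "z \<in> carrier S" for z
      using that x(2) by (simp add: S.minus_eq)
    moreover have sum: "s [^] n \<oplus> x \<otimes> c \<in> carrier R" using x(2) s(1) c by simp
    ultimately have "h (s [^] n \<oplus> x \<otimes> c) \<in> Q" by (metis hom_closed)
    then have "s [^] n \<oplus> x \<otimes> c \<in> P" using QP sum by blast
    moreover have "x \<otimes> c \<in> P" using x c by (simp add: P.I_r_closed)
    ultimately have "(s [^] n \<oplus> x \<otimes> c) \<ominus> x \<otimes> c \<in> P"
      unfolding R.minus_eq by (rule P.a_closed[OF _ P.a_inv_closed])
    moreover have "(s [^] n \<oplus> x \<otimes> c) \<ominus> x \<otimes> c = s [^] n"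
      using s x(2) c by (simp add: R.minus_eq R.a_assoc R.r_neg)
    ultimately have "s [^] n \<in> P" by simp
    then show False
    proof (induction n)
      case 0
      then show ?case using P.I_notcarr P.one_imp_carrier by auto
    next
      case (Suc n)
      then show ?case using P.I_prime[of "s [^] n" s] s by auto
    qed
  qed
  ultimately show ?thesis using JQ QP by blast
qed

text \<open>
  Take \<open>b\<close> in \<open>Q'\<close> but not in \<open>Q\<close>. Then no monic value \<open>v\<close> at \<open>b\<close> lies in \<open>Q\<close>, not even \<open>0\<close>. Indeed, if
  \<open>v = b w + a\<close> did, then the constant term \<open>a\<close> would be in \<open>Q'\<close> because \<open>v\<close> and \<open>b\<close> are, hence in
  \<open>Q\<close> by the equality of the contractions, so \<open>b w\<close> and therefore \<open>w\<close>, a monic value of lower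
  degree, would be in \<open>Q\<close>.
\<close>

lemma incomparability:
  assumes int: "\<And>b. b \<in> carrier S \<Longrightarrow> \<exists>n. \<zero>\<^bsub>S\<^esub> \<in> poly_values b \<one> n"
    and Q: "primeideal Q S" and Q': "primeideal Q' S" and sub: "Q \<subseteq> Q'"
    and eq: "{r \<in> carrier R. h r \<in> Q} = {r \<in> carrier R. h r \<in> Q'}"
  shows "Q = Q'"
proof (rule ccontr)
  interpret Q: primeideal Q S by fact
  interpret Q': primeideal Q' S by fact
  assume "Q \<noteq> Q'"
  then obtain b where b: "b \<in> Q'" "b \<notin> Q" "b \<in> carrier S" using sub by (auto dest: Q'.Icarr)
  have "v \<notin> Q" if "v \<in> poly_values b \<one> n" for n v
    using that
  proof (induction n arbitrary: v)
    case 0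
    then show ?case using Q.I_notcarr Q.one_imp_carrier by auto
  next
    case (Suc n)
    then obtain w a where v: "v = b \<otimes>\<^bsub>S\<^esub> w \<oplus>\<^bsub>S\<^esub> h a" "w \<in> poly_values b \<one> n" "a \<in> carrier R"
      by auto
    then have w: "w \<in> carrier S" using poly_values_closed b by blast
    show ?case
    proof
      assume vQ: "v \<in> Q"
      have "v \<ominus>\<^bsub>S\<^esub> b \<otimes>\<^bsub>S\<^esub> w \<in> Q'"
        unfolding S.minus_eq using vQ sub b w
        by (intro Q'.a_closed Q'.a_inv_closed Q'.I_r_closed) auto
      moreover have "v \<ominus>\<^bsub>S\<^esub> b \<otimes>\<^bsub>S\<^esub> w = h a"
        unfolding v(1) using hom_closed[OF v(3)] w b(3) by algebra
      ultimately have "h a \<in> Q" using eq v(3) by auto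
      then have "v \<ominus>\<^bsub>S\<^esub> h a \<in> Q"
        unfolding S.minus_eq using vQ by (intro Q.a_closed Q.a_inv_closed) auto
      moreover have "v \<ominus>\<^bsub>S\<^esub> h a = b \<otimes>\<^bsub>S\<^esub> w"
        unfolding v(1) using hom_closed[OF v(3)] w b(3) by algebra
      ultimately have "b \<otimes>\<^bsub>S\<^esub> w \<in> Q" by simp
      then show False using Q.I_prime[OF b(3) w] b(2) Suc.IH[OF v(2)] by blast
    qed
  qed
  then show False using int[OF b(3)] Q.zero_closed by blast
qed

end

theorem krull_dim_integral_extension:
  assumes "integral_extension A B h"
  shows "krull_dim A = krull_dim B"
proof -
  interpret ring_hom_cring A B h
    using assms unfolding integral_extension_def ring_extension_def by blast
  have inj: "inj_on h (carrier A)"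
    using assms unfolding integral_extension_def ring_extension_def by blast
  have int: "\<exists>n. \<zero>\<^bsub>B\<^esub> \<in> poly_values b \<one>\<^bsub>A\<^esub> n" if "b \<in> carrier B" for b
    using assms integral_over_iff[OF that] that unfolding integral_extension_def by blast
  let ?c = "\<lambda>Q. {r \<in> carrier A. h r \<in> Q}"
  have "(\<exists>P. (\<forall>i\<le>n. primeideal (P i) A) \<and> (\<forall>i<n. P i \<subset> P (Suc i))) \<longleftrightarrow>
        (\<exists>Q. (\<forall>i\<le>n. primeideal (Q i) B) \<and> (\<forall>i<n. Q i \<subset> Q (Suc i)))" for n :: nat
  proof
    assume "\<exists>P. (\<forall>i\<le>n. primeideal (P i) A) \<and> (\<forall>i<n. P i \<subset> P (Suc i))"
    then obtain P where P: "\<forall>i\<le>n. primeideal (P i) A" "\<forall>i<n. P i \<subset> P (Suc i)" by blast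
    have "m \<le> n \<Longrightarrow> \<exists>Q. (\<forall>i\<le>m. primeideal (Q i) B \<and> ?c (Q i) = P i) \<and> (\<forall>i<m. Q i \<subset> Q (Suc i))" for m
    proof (induction m)
      case 0
      \<comment> \<open>Injectivity enters here: the zero ideal contracts to zero, hence into every prime.\<close>
      have P0: "primeideal (P 0) A" using P by simp
      interpret P0: primeideal "P 0" A by fact
      have "?c {\<zero>\<^bsub>B\<^esub>} \<subseteq> P 0"
      proof
        fix r assume "r \<in> ?c {\<zero>\<^bsub>B\<^esub>}"
        then have "r = \<zero>\<^bsub>A\<^esub>" using inj_onD[OF inj, of r "\<zero>\<^bsub>A\<^esub>"] by simp
        then show "r \<in> P 0" by simp
      qed
      from lying_over[OF int P0 S.zeroideal this]
      obtain Q where "primeideal Q B" "?c Q = P 0" by blast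
      then show ?case by (intro exI[of _ "\<lambda>_. Q"]) simp
    next
      case (Suc m)
      then obtain Q where Q: "\<forall>i\<le>m. primeideal (Q i) B \<and> ?c (Q i) = P i" "\<forall>i<m. Q i \<subset> Q (Suc i)"
        by auto
      have PS: "primeideal (P (Suc m)) A" and less: "P m \<subset> P (Suc m)" using P Suc.prems by auto
      have "ideal (Q m) B" using Q(1) primeideal.axioms(1) by blast
      moreover have "?c (Q m) \<subseteq> P (Suc m)" using Q(1) less by auto
      ultimately obtain Q' where Q': "primeideal Q' B" "Q m \<subseteq> Q'" "?c Q' = P (Suc m)"
        using lying_over[OF int PS] by blast
      have "Q m \<noteq> Q'" using Q(1) Q'(3) less by auto
      then have "Q m \<subset> Q'" using Q'(2) by blast
      then show ?case
        using Q Q' by (intro exI[of _ "Q(Suc m := Q')"]) (auto simp: le_Suc_eq less_Suc_eq)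
    qed
    from this[of n] show "\<exists>Q. (\<forall>i\<le>n. primeideal (Q i) B) \<and> (\<forall>i<n. Q i \<subset> Q (Suc i))" by blast
  next
    assume "\<exists>Q. (\<forall>i\<le>n. primeideal (Q i) B) \<and> (\<forall>i<n. Q i \<subset> Q (Suc i))"
    then obtain Q where Q: "\<forall>i\<le>n. primeideal (Q i) B" "\<forall>i<n. Q i \<subset> Q (Suc i)" by blast
    have "?c (Q i) \<subset> ?c (Q (Suc i))" if i: "i < n" for i
    proof -
      have "primeideal (Q i) B" "primeideal (Q (Suc i)) B" "Q i \<subset> Q (Suc i)" using Q i by auto
      then have "?c (Q i) \<noteq> ?c (Q (Suc i))"
        using incomparability[OF int \<open>primeideal (Q i) B\<close> \<open>primeideal (Q (Suc i)) B\<close>]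
        by (metis psubset_imp_subset psubset_eq)
      moreover have "?c (Q i) \<subseteq> ?c (Q (Suc i))" using \<open>Q i \<subset> Q (Suc i)\<close> by fast
      ultimately show ?thesis by (rule psubsetI[rotated])
    qed
    then show "\<exists>P. (\<forall>i\<le>n. primeideal (P i) A) \<and> (\<forall>i<n. P i \<subset> P (Suc i))"
      using Q(1) contraction_prime
      by (intro exI[of _ "\<lambda>i. ?c (Q i)"] conjI allI impI) simp_all
  qed
  then show ?thesis unfolding krull_dim_def by simp
qed

section \<open>Powers of ideals\<close>

lemma (in ring) ideal_finsum_closed:
  assumes K: "ideal K R"
  shows "(\<And>i. i \<le> (n::nat) \<Longrightarrow> f i \<in> K) \<Longrightarrow> (\<Oplus>i\<in>{..n}. f i) \<in> K"
proof (induction n)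
  case 0
  then show ?case using ideal.Icarr[OF K] by simp
next
  case (Suc n)
  interpret K: ideal K R by fact
  have "(\<Oplus>i\<in>{..Suc n}. f i) = f (Suc n) \<oplus> (\<Oplus>i\<in>{..n}. f i)"
    using Suc.prems by (intro finsum_Suc) (auto intro: K.Icarr)
  then show ?case using Suc by (auto intro: K.a_closed)
qed

lemma one_ideals_set: "\<one>\<^bsub>ideals_set R\<^esub> = carrier R"
  by (simp add: ideals_set_def)

context cring
begin

lemma ideal_pow_ideal:
  assumes "ideal I R"
  shows "ideal (I [^]\<^bsub>ideals_set R\<^esub> (n::nat)) R"
proof -
  interpret M: comm_monoid "ideals_set R" by (rule ideals_set_is_comm_monoid)
  have "I \<in> carrier (ideals_set R)" using assms by (simp add: ideals_set_def)
  from M.nat_pow_closed[OF this, of n] show ?thesis by (simp add: ideals_set_def)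
qed

lemma ideal_pow_mult:
  assumes "ideal I R" and a: "a \<in> I [^]\<^bsub>ideals_set R\<^esub> m" and b: "b \<in> I [^]\<^bsub>ideals_set R\<^esub> n"
  shows "a \<otimes> b \<in> I [^]\<^bsub>ideals_set R\<^esub> (m + n :: nat)"
proof -
  interpret M: comm_monoid "ideals_set R" by (rule ideals_set_is_comm_monoid)
  have "I \<in> carrier (ideals_set R)" using assms by (simp add: ideals_set_def)
  then have "I [^]\<^bsub>ideals_set R\<^esub> (m + n) = ideal_prod R (I [^]\<^bsub>ideals_set R\<^esub> m) (I [^]\<^bsub>ideals_set R\<^esub> n)"
    by (simp add: M.nat_pow_mult[symmetric]) (simp add: ideals_set_def)
  then show ?thesis using a b by (simp add: ideal_prod.prod)
qed

end

section \<open>Monic polynomials and the Rees algebra\<close>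

context UP_cring
begin

text \<open>
  Over a ring with zero divisors the degree of a product may drop. If one factor is monic it does
  not, because the leading coefficient of the other survives.
\<close>

lemma coeff_mult_monic_top:
  assumes x: "x \<in> carrier P" and f: "f \<in> carrier P" and monic: "coeff P f (deg R f) = \<one>"
  shows "coeff P (x \<otimes>\<^bsub>P\<^esub> f) (deg R x + deg R f) = coeff P x (deg R x)"
proof -
  let ?d = "deg R x" and ?k = "deg R f"
  have "coeff P (x \<otimes>\<^bsub>P\<^esub> f) (?d + ?k) =
     (\<Oplus>i\<in>{..?d + ?k}. coeff P x i \<otimes> coeff P f (?d + ?k - i))"
    using x f by simp
  also have "\<dots> = (\<Oplus>i\<in>{..?d + ?k}. if ?d = i then coeff P x i else \<zero>)"
  proof (intro R.finsum_cong')
    fix i assume "i \<in> {..?d + ?k}"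
    consider "i = ?d" | "i < ?d" | "?d < i" by linarith
    then show "coeff P x i \<otimes> coeff P f (?d + ?k - i) = (if ?d = i then coeff P x i else \<zero>)"
    proof cases
      case 2
      then show ?thesis using deg_aboveD[of f "?d + ?k - i"] x f by simp
    next
      case 3
      then show ?thesis using deg_aboveD[of x i] x f by simp
    qed (use x f monic in simp)
  qed (use x in auto)
  also have "\<dots> = coeff P x ?d"
    using x by (intro R.finsum_singleton) auto
  finally show ?thesis .
qed

lemma const_in_monic_ideal_imp_zero:
  assumes f: "f \<in> carrier P" and monic: "coeff P f (deg R f) = \<one>" and pos: "deg R f > 0"
    and r: "r \<in> carrier R" and mem: "monom P r 0 \<in> PIdl\<^bsub>P\<^esub> f"
  shows "r = \<zero>"
proof -
  obtain x where x: "x \<in> carrier P" "monom P r 0 = x \<otimes>\<^bsub>P\<^esub> f"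
    using mem unfolding cgenideal_def by blast
  have "coeff P x (deg R x) = coeff P (monom P r 0) (deg R x + deg R f)"
    using coeff_mult_monic_top[OF x(1) f monic] x(2) by simp
  also have "\<dots> = \<zero>" using r pos by simp
  finally have "x = \<zero>\<^bsub>P\<^esub>" using lcoeff_nonzero[of x] x(1) by blast
  then have "monom P r 0 = \<zero>\<^bsub>P\<^esub>" using x f by simp
  then have "coeff P (monom P r 0) 0 = coeff P \<zero>\<^bsub>P\<^esub> 0" by simp
  then show ?thesis using r by simp
qed

lemma monic_division:
  assumes f: "f \<in> carrier P" and monic: "coeff P f (deg R f) = \<one>" and pos: "deg R f > 0"
    and p: "p \<in> carrier P"
  shows "\<exists>q\<in>carrier P. \<exists>r\<in>carrier P. p = q \<otimes>\<^bsub>P\<^esub> f \<oplus>\<^bsub>P\<^esub> r \<and> deg R r < deg R f"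
proof -
  have "f \<noteq> \<zero>\<^bsub>P\<^esub>" using pos by auto
  from long_div_theorem[OF f p this] obtain q r and l :: nat where
    qr: "q \<in> carrier P" "r \<in> carrier P" "\<one> [^] l \<odot>\<^bsub>P\<^esub> p = f \<otimes>\<^bsub>P\<^esub> q \<oplus>\<^bsub>P\<^esub> r"
    "r = \<zero>\<^bsub>P\<^esub> \<or> deg R r < deg R f"
    unfolding monic by blast
  have "p = q \<otimes>\<^bsub>P\<^esub> f \<oplus>\<^bsub>P\<^esub> r" using qr p f by (simp add: UP_m_comm)
  moreover have "deg R r < deg R f" using qr(4) pos by auto
  ultimately show ?thesis using qr by blast
qed

text \<open>
  Closure under products is the inclusion \<open>I\<^sup>i I\<^sup>j \<subseteq> I\<^sup>i\<^sup>+\<^sup>j\<close> applied to each term of the convolution.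
\<close>

lemma rees_algebra_subcring:
  assumes I: "ideal I R"
  shows "subcring (carrier (rees_algebra R I)) P"
proof (intro P.subcringI' P.subringI)
  let ?I = "\<lambda>n::nat. I [^]\<^bsub>ideals_set R\<^esub> n"
  have mem: "p \<in> carrier (rees_algebra R I) \<longleftrightarrow> p \<in> carrier P \<and> (\<forall>n. coeff P p n \<in> ?I n)" for p
    unfolding rees_algebra_def P_def by simp
  have additive: "additive_subgroup (?I n) R" for n
    using R.ideal_pow_ideal[OF I] ideal.axioms(1) by blast
  note [simp] = additive_subgroup.zero_closed[OF additive]
    additive_subgroup.a_closed[OF additive] additive_subgroup.a_inv_closed[OF additive]
  show "carrier (rees_algebra R I) \<subseteq> carrier P" using mem by blast
  show "\<one>\<^bsub>P\<^esub> \<in> carrier (rees_algebra R I)"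
    unfolding mem by (auto simp: one_ideals_set)
  fix p assume p: "p \<in> carrier (rees_algebra R I)"
  show "\<ominus>\<^bsub>P\<^esub> p \<in> carrier (rees_algebra R I)"
    using p unfolding mem by simp
  fix q assume q: "q \<in> carrier (rees_algebra R I)"
  show "p \<oplus>\<^bsub>P\<^esub> q \<in> carrier (rees_algebra R I)"
    using p q unfolding mem by simp
  show "p \<otimes>\<^bsub>P\<^esub> q \<in> carrier (rees_algebra R I)"
    unfolding mem
  proof (intro conjI allI)
    show "p \<otimes>\<^bsub>P\<^esub> q \<in> carrier P" using p q mem by simp
    fix n
    have "(\<Oplus>i\<in>{..n}. coeff P p i \<otimes> coeff P q (n - i)) \<in> ?I n"
    proof (rule R.ideal_finsum_closed[OF R.ideal_pow_ideal[OF I]])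
      fix i assume "i \<le> n"
      then show "coeff P p i \<otimes> coeff P q (n - i) \<in> ?I n"
        using R.ideal_pow_mult[OF I, of "coeff P p i" i "coeff P q (n - i)" "n - i"] p q mem by simp
    qed
    then show "coeff P (p \<otimes>\<^bsub>P\<^esub> q) n \<in> ?I n" using p q mem by simp
  qed
qed

end

section \<open>The Rees quotient between the base ring and the polynomial quotient\<close>

theorem proposition1p3:
  fixes R :: "('a, 'm) ring_scheme"
    and I :: "'a set" and f :: "nat \<Rightarrow> 'a" and k :: nat
  assumes "cring R"
    and "ideal I R" and "I \<noteq> carrier R"
    and "UP_monic R f" and "deg R f = k" and "k > 0"
  shows "integral_extension R (rees_quotient R I f) (base_to_rees R I f)
       \<and> integral_extension (rees_quotient R I f) (UP_quotient R f) (rees_to_UP R f)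
       \<and> krull_dim R = krull_dim (rees_quotient R I f)
       \<and> krull_dim (rees_quotient R I f) = krull_dim (UP_quotient R f)"
proof -
  interpret R: cring R by fact
  interpret UP_cring R "UP R" by unfold_locales simp
  have f: "f \<in> carrier (UP R)" and monic: "coeff (UP R) f (deg R f) = \<one>\<^bsub>R\<^esub>"
    using assms(4) unfolding UP_monic_def by auto
  have pos: "deg R f > 0" using assms by simp
  let ?J = "PIdl\<^bsub>UP R\<^esub> f" and ?A = "rees_algebra R I" and ?B = "rees_quotient R I f"
    and ?C = "UP_quotient R f"
  let ?\<pi> = "\<lambda>p. ?J +>\<^bsub>UP R\<^esub> p"
  have J: "ideal ?J (UP R)" by (rule P.cgenideal_ideal[OF f])
  interpret \<pi>: ring_hom_cring "UP R" ?C ?\<pi>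
    unfolding UP_quotient_def by (rule ideal.rcos_ring_hom_cring[OF J UP_cring])
  have \<pi>_zero: "?\<pi> p = \<zero>\<^bsub>?C\<^esub> \<longleftrightarrow> p \<in> ?J" if "p \<in> carrier (UP R)" for p
    using ideal.rcos_const_imp_mem[OF J that] P.a_rcos_zero[OF J]
    unfolding UP_quotient_def FactRing_def by auto
  have \<pi>_surj: "\<exists>p\<in>carrier (UP R). y = ?\<pi> p" if "y \<in> carrier ?C" for y
    using that unfolding UP_quotient_def FactRing_simps by auto
  have sub: "carrier ?A \<subseteq> carrier (UP R)" unfolding rees_algebra_def by auto
  have A_eq: "UP R\<lparr>carrier := carrier ?A\<rparr> = ?A" unfolding rees_algebra_def by simp
  have A_cring: "cring ?A"
    using rees_algebra_subcring[OF assms(2)] P.subcring_iff[OF sub] A_eq by simp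
  interpret A: cring ?A by (rule A_cring)
  have A_ops: "monoid.mult ?A = monoid.mult (UP R)" "ring.add ?A = ring.add (UP R)" "monoid.one ?A = monoid.one (UP R)"
    unfolding rees_algebra_def by simp_all
  have "?\<pi> \<in> ring_hom ?A ?C"
    by (intro ring_hom_memI) (simp_all add: A_ops subsetD[OF sub])
  then interpret \<rho>: ring_hom_cring ?A ?C ?\<pi>
    by (intro ring_hom_cring.intro A_cring \<pi>.S.is_cring ring_hom_cring_axioms.intro)
  \<comment> \<open>The Rees ideal is a kernel, so the induced map on the quotient is well defined and injective.\<close>
  have ker: "a_kernel ?A ?C ?\<pi> = rees_ideal R I f"
    unfolding a_kernel_def' rees_ideal_def using sub \<pi>_zero by auto
  have B_eq: "?B = ?A Quot a_kernel ?A ?C ?\<pi>" unfolding rees_quotient_def ker ..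
  have const_A: "monom (UP R) r 0 \<in> carrier ?A" if r: "r \<in> carrier R" for r
  proof -
    have "\<zero>\<^bsub>R\<^esub> \<in> I [^]\<^bsub>ideals_set R\<^esub> n" for n :: nat
      using additive_subgroup.zero_closed[OF ideal.axioms(1)[OF R.ideal_pow_ideal[OF assms(2)]]] .
    then show ?thesis using r unfolding rees_algebra_def by (auto simp: one_ideals_set)
  qed
  have const_hom: "(\<lambda>r. monom (UP R) r 0) \<in> ring_hom R ?A"
    using const_A ring_hom_mult[OF const_ring_hom] ring_hom_add[OF const_ring_hom]
      ring_hom_one[OF const_ring_hom]
    by (intro ring_hom_memI) (auto simp: A_ops)
  have K: "ideal (a_kernel ?A ?C ?\<pi>) ?A" by (rule \<rho>.ring.kernel_is_ideal)
  have B_cring: "cring ?B" unfolding B_eq by (rule ideal.quotient_is_cring[OF K A_cring])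
  have base: "base_to_rees R I f = (\<lambda>p. a_kernel ?A ?C ?\<pi> +>\<^bsub>?A\<^esub> p) \<circ> (\<lambda>r. monom (UP R) r 0)"
    unfolding base_to_rees_def ker by (simp add: comp_def)
  have base_hom: "base_to_rees R I f \<in> ring_hom R ?B"
    unfolding base B_eq by (rule ring_hom_trans[OF const_hom ideal.rcos_ring_hom[OF K]])
  have g: "rees_to_UP R f = (\<lambda>X. the_elem (?\<pi> ` X))" unfolding rees_to_UP_def ..
  have g_hom: "rees_to_UP R f \<in> ring_hom ?B ?C"
    unfolding g B_eq by (rule \<rho>.ring.the_elem_hom)
  have g_inj: "inj_on (rees_to_UP R f) (carrier ?B)"
    unfolding g B_eq by (rule inj_onI) (rule \<rho>.ring.the_elem_inj)
  have comp: "(rees_to_UP R f \<circ> base_to_rees R I f) r = ?\<pi> (monom (UP R) r 0)"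
    if "r \<in> carrier R" for r
    using \<rho>.ring.the_elem_simp[OF const_A[OF that]] unfolding g base by simp
  interpret RB: ring_hom_cring R ?B "base_to_rees R I f"
    by (intro ring_hom_cring.intro R.is_cring B_cring ring_hom_cring_axioms.intro base_hom)
  interpret BC: ring_hom_cring ?B ?C "rees_to_UP R f"
    by (intro ring_hom_cring.intro B_cring \<pi>.S.is_cring ring_hom_cring_axioms.intro g_hom)
  interpret RC: ring_hom_cring R ?C "rees_to_UP R f \<circ> base_to_rees R I f"
    by (intro ring_hom_cring.intro R.is_cring \<pi>.S.is_cring ring_hom_cring_axioms.intro
        ring_hom_trans[OF base_hom g_hom])
  have RC_inj: "inj_on (rees_to_UP R f \<circ> base_to_rees R I f) (carrier R)"
    unfolding RC.ring.inj_iff_trivial_ker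
  proof
    show "a_kernel R ?C (rees_to_UP R f \<circ> base_to_rees R I f) \<subseteq> {\<zero>\<^bsub>R\<^esub>}"
      using const_in_monic_ideal_imp_zero[OF f monic pos] \<pi>_zero comp
      unfolding a_kernel_def' by auto
    show "{\<zero>\<^bsub>R\<^esub>} \<subseteq> a_kernel R ?C (rees_to_UP R f \<circ> base_to_rees R I f)"
      using RC.hom_zero unfolding a_kernel_def' by simp
  qed
  \<comment> \<open>The generators are numbered from 0 to \<open>k - 1\<close>.\<close>
  define n where "n = deg R f - 1"
  have span: "\<exists>a. (\<forall>j\<le>n. a j \<in> carrier R) \<and>
      y = (\<Oplus>\<^bsub>?C\<^esub>j\<in>{..n}. (rees_to_UP R f \<circ> base_to_rees R I f) (a j) \<otimes>\<^bsub>?C\<^esub> ?\<pi> (monom (UP R) \<one>\<^bsub>R\<^esub> j))"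
    if y: "y \<in> carrier ?C" for y
  proof -
    obtain p where p: "p \<in> carrier (UP R)" "y = ?\<pi> p" using \<pi>_surj[OF y] by blast
    from monic_division[OF f monic pos p(1)] obtain q r where qr: "q \<in> carrier (UP R)"
      "r \<in> carrier (UP R)" "p = q \<otimes>\<^bsub>UP R\<^esub> f \<oplus>\<^bsub>UP R\<^esub> r" "deg R r < deg R f" by blast
    have "?\<pi> (q \<otimes>\<^bsub>UP R\<^esub> f) = \<zero>\<^bsub>?C\<^esub>"
      using \<pi>_zero[of "q \<otimes>\<^bsub>UP R\<^esub> f"] qr f unfolding cgenideal_def by auto
    then have y_eq: "y = ?\<pi> r" unfolding p(2) qr(3) using qr f by simp
    let ?c = "coeff (UP R) r"
    have "r = (\<Oplus>\<^bsub>UP R\<^esub>j\<in>{..n}. monom (UP R) (?c j) j)"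
      using qr unfolding n_def by (intro up_repr_le[symmetric]) auto
    then have "y = ?\<pi> (\<Oplus>\<^bsub>UP R\<^esub>j\<in>{..n}. monom (UP R) (?c j) j)" using y_eq by simp
    also have "\<dots> = (\<Oplus>\<^bsub>?C\<^esub>j\<in>{..n}. ?\<pi> (monom (UP R) (?c j) j))"
      using \<pi>.ring.hom_finsum[of "\<lambda>j. monom (UP R) (?c j) j" "{..n}"] qr by (simp add: comp_def)
    also have "\<dots> = (\<Oplus>\<^bsub>?C\<^esub>j\<in>{..n}. (rees_to_UP R f \<circ> base_to_rees R I f) (?c j) \<otimes>\<^bsub>?C\<^esub> ?\<pi> (monom (UP R) \<one>\<^bsub>R\<^esub> j))"
    proof (intro \<pi>.S.finsum_cong')
      fix j
      have c: "?c j \<in> carrier R" using qr by simp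
      have "monom (UP R) (?c j) j = monom (UP R) (?c j) 0 \<otimes>\<^bsub>UP R\<^esub> monom (UP R) \<one>\<^bsub>R\<^esub> j"
        using monom_mult[OF c R.one_closed, of 0 j] c by simp
      then show "?\<pi> (monom (UP R) (?c j) j)
          = (rees_to_UP R f \<circ> base_to_rees R I f) (?c j) \<otimes>\<^bsub>?C\<^esub> ?\<pi> (monom (UP R) \<one>\<^bsub>R\<^esub> j)"
        unfolding comp[OF c] using c by simp
    next
      show "(\<lambda>j. (rees_to_UP R f \<circ> base_to_rees R I f) (?c j) \<otimes>\<^bsub>?C\<^esub> ?\<pi> (monom (UP R) \<one>\<^bsub>R\<^esub> j)) \<in> {..n} \<rightarrow> carrier ?C"
        using qr(2) by (intro Pi_I \<pi>.S.m_closed RC.hom_closed \<pi>.hom_closed) auto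
    qed simp
    finally show ?thesis using qr(2) by (intro exI[of _ ?c]) simp
  qed
  have "integral_extension R ?C (rees_to_UP R f \<circ> base_to_rees R I f)"
    unfolding integral_extension_def ring_extension_def
  proof (intro conjI ballI RC.ring_hom_cring_axioms RC_inj)
    fix b assume b: "b \<in> carrier ?C"
    show "integral_over R ?C (rees_to_UP R f \<circ> base_to_rees R I f) b"
      unfolding RC.integral_over_iff[OF b]
    proof (rule RC.finite_imp_integral[OF b _ _ span])
      show "?\<pi> (monom (UP R) \<one>\<^bsub>R\<^esub> j) \<in> carrier ?C" for j by simp
      show "?\<pi> (monom (UP R) \<one>\<^bsub>R\<^esub> 0) = \<one>\<^bsub>?C\<^esub>" by simp
    qed
  qed
  moreover have "ring_extension R ?B (base_to_rees R I f)"
    unfolding ring_extension_def using RB.ring_hom_cring_axioms inj_on_imageI2[OF RC_inj] by blast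
  moreover have "ring_extension ?B ?C (rees_to_UP R f)"
    unfolding ring_extension_def using BC.ring_hom_cring_axioms g_inj by blast
  ultimately have "integral_extension R ?B (base_to_rees R I f)"
    "integral_extension ?B ?C (rees_to_UP R f)"
    using integral_extension_tower by blast+
  then show ?thesis
    using krull_dim_integral_extension[of R ?B] krull_dim_integral_extension[of ?B ?C] by simp
qed

end
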